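(* The map $G':\mathcal M'\to Q$ defined in the context is bijective.
   Context: Let $V=\{(3,1),(3,3)\}\cup\{(i,0),(i,2),(i,4):i=1,2,4\}$ and let $i_a$ ($(i,a)\in V$) be commuting indeterminates; $\mathcal M$ is the set of monomials (nonnegative exponents) in them. Put $F_3=3_13_3$, $F_i=i_0i_2i_4$ for $i=1,2,4$, and let $\mathcal M'\subset\mathcal M$ be the set of monomials not divisible by any of $F_1,\dots,F_4$. Let $Q=\bigoplus_{i=0}^6\mathbb Z\alpha_i$ (the root lattice of type $E_6^{(1)}$). Every $m\in\mathcal M$ has a unique expression with nonnegative integer exponents $$m=\prod_{i=1}^4F_i^{a_i}\cdot3_1^p3_3^q\cdot\prod_{i=1,2,4}(i_2i_4)^{p_i}(i_0i_4)^{q_i}(i_0i_2)^{r_i}\cdot\prod_{i=1,2,4}i_0^{s_i}i_2^{t_i}i_4^{u_i}$$ such that each of the tuples $(p,q)$ and, for $i=1,2,4$, $(p_i,q_i,r_i)$, $(s_i,t_i,u_i)$, $(p_i,s_i)$, $(q_i,t_i)$, $(r_i,u_i)$ has at most one nonzero entry. Put $(v_1,w_1)=(1,2)$, $(v_2,w_2)=(0,4)$, $(v_4,w_4)=(6,5)$. Define $G:\mathcal M\to Q$ by $$G(m)=(q-p)\alpha_3+\sum_{i=1,2,4}\Big(-p_i\alpha_{v_i}+q_i(\alpha_{v_i}+2\alpha_{w_i}+\alpha_3)+r_i\alpha_{v_i}+s_i(\alpha_{v_i}+\alpha_{w_i})-t_i\alpha_{w_i}+u_i(\alpha_{w_i}+\alpha_3)\Big).$$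 Let $G'$ be the restriction of $G$ to $\mathcal M'$. *)

theory Defs
  imports "HOL-Library.Multiset" "HOL-Library.FuncSet" "HOL-Algebra.Free_Abelian_Groups"
begin

text \<open>
  A monomial in commuting indeterminates is encoded as the multiset of its factors: the
  indeterminate \<open>i\<^sub>a\<close> is \<open>{#(i, a)#}\<close>, products are sums of multisets, the \<open>n\<close>-th power
  is \<^const>\<open>repeat_mset\<close> \<open>n\<close>, and divisibility is \<open>\<subseteq>#\<close>.
\<close>

definition vertices :: "(nat \<times> nat) set" where
  "vertices = {(3, 1), (3, 3)} \<union> {1, 2, 4} \<times> {0, 2, 4}"

definition monomials :: "(nat \<times> nat) multiset set" where
  "monomials = {m. set_mset m \<subseteq> vertices}"

definition F_monomial :: "nat \<Rightarrow> (nat \<times> nat) multiset" where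
  "F_monomial i = (if i = 3 then {#(3, 1), (3, 3)#} else {#(i, 0), (i, 2), (i, 4)#})"

definition monomials' :: "(nat \<times> nat) multiset set" where
  "monomials' = {m \<in> monomials. \<forall>i\<in>{1..4}. \<not> F_monomial i \<subseteq># m}"

text \<open>
  The exponents of an expression. The fields \<open>ex_p\<close>, \<open>ex_q\<close> are the exponents of \<open>3\<^sub>1\<close> and
  \<open>3\<^sub>3\<close>; the indexed fields are functions of \<open>i\<close>.
\<close>

record exponents =
  ex_a :: "nat \<Rightarrow> nat"
  ex_p :: nat
  ex_q :: nat
  ex_pi :: "nat \<Rightarrow> nat"
  ex_qi :: "nat \<Rightarrow> nat"
  ex_ri :: "nat \<Rightarrow> nat"
  ex_si :: "nat \<Rightarrow> nat"
  ex_ti :: "nat \<Rightarrow> nat"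
  ex_ui :: "nat \<Rightarrow> nat"

definition expression_value :: "exponents \<Rightarrow> (nat \<times> nat) multiset" where
  "expression_value e =
     (\<Sum>i\<in>{1..4}. repeat_mset (ex_a e i) (F_monomial i))
     + repeat_mset (ex_p e) {#(3, 1)#} + repeat_mset (ex_q e) {#(3, 3)#}
     + (\<Sum>i\<in>{1, 2, 4}. repeat_mset (ex_pi e i) {#(i, 2), (i, 4)#}
                     + repeat_mset (ex_qi e i) {#(i, 0), (i, 4)#}
                     + repeat_mset (ex_ri e i) {#(i, 0), (i, 2)#})
     + (\<Sum>i\<in>{1, 2, 4}. repeat_mset (ex_si e i) {#(i, 0)#}
                     + repeat_mset (ex_ti e i) {#(i, 2)#}
                     + repeat_mset (ex_ui e i) {#(i, 4)#})"

definition at_most_one_nonzero :: "nat list \<Rightarrow> bool" where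
  "at_most_one_nonzero xs \<longleftrightarrow> length (filter (\<lambda>x. x \<noteq> 0) xs) \<le> 1"

definition admissible :: "exponents \<Rightarrow> bool" where
  "admissible e \<longleftrightarrow>
     at_most_one_nonzero [ex_p e, ex_q e] \<and>
     (\<forall>i\<in>{1, 2, 4}.
        at_most_one_nonzero [ex_pi e i, ex_qi e i, ex_ri e i] \<and>
        at_most_one_nonzero [ex_si e i, ex_ti e i, ex_ui e i] \<and>
        at_most_one_nonzero [ex_pi e i, ex_si e i] \<and>
        at_most_one_nonzero [ex_qi e i, ex_ti e i] \<and>
        at_most_one_nonzero [ex_ri e i, ex_ui e i])"

text \<open>
  Only the values of the exponent functions at their proper indices are meaningful; they are
  set to zero elsewhere, so that a family of exponents is a single HOL object.
\<close>

definition proper_support :: "exponents \<Rightarrow> bool" where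
  "proper_support e \<longleftrightarrow>
     (\<forall>i. i \<notin> {1..4} \<longrightarrow> ex_a e i = 0) \<and>
     (\<forall>i. i \<notin> {1, 2, 4} \<longrightarrow>
        ex_pi e i = 0 \<and> ex_qi e i = 0 \<and> ex_ri e i = 0 \<and>
        ex_si e i = 0 \<and> ex_ti e i = 0 \<and> ex_ui e i = 0)"

definition expresses :: "exponents \<Rightarrow> (nat \<times> nat) multiset \<Rightarrow> bool" where
  "expresses e m \<longleftrightarrow> proper_support e \<and> admissible e \<and> m = expression_value e"

text \<open>The root lattice, with simple roots \<open>\<alpha>\<^sub>i\<close> as free generators.\<close>

definition root_lattice :: "(nat \<Rightarrow>\<^sub>0 int) set" where
  "root_lattice = carrier (free_Abelian_group {0..6})"

definition \<alpha> :: "nat \<Rightarrow> (nat \<Rightarrow>\<^sub>0 int)" where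
  "\<alpha> i = frag_of i"

text \<open>The indices \<open>v\<^sub>i\<close> and \<open>w\<^sub>i\<close>, used for \<open>i = 1, 2, 4\<close> only.\<close>

definition v_index :: "nat \<Rightarrow> nat" where
  "v_index i = (if i = 1 then 1 else if i = 2 then 0 else 6)"

definition w_index :: "nat \<Rightarrow> nat" where
  "w_index i = (if i = 1 then 2 else if i = 2 then 4 else 5)"

definition exponents_weight :: "exponents \<Rightarrow> (nat \<Rightarrow>\<^sub>0 int)" where
  "exponents_weight e =
     frag_cmul (int (ex_q e) - int (ex_p e)) (\<alpha> 3)
     + (\<Sum>i\<in>{1, 2, 4}.
          - frag_cmul (int (ex_pi e i)) (\<alpha> (v_index i))
          + frag_cmul (int (ex_qi e i)) (\<alpha> (v_index i) + frag_cmul 2 (\<alpha> (w_index i)) + \<alpha> 3)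
          + frag_cmul (int (ex_ri e i)) (\<alpha> (v_index i))
          + frag_cmul (int (ex_si e i)) (\<alpha> (v_index i) + \<alpha> (w_index i))
          - frag_cmul (int (ex_ti e i)) (\<alpha> (w_index i))
          + frag_cmul (int (ex_ui e i)) (\<alpha> (w_index i) + \<alpha> 3))"

definition G :: "(nat \<times> nat) multiset \<Rightarrow> (nat \<Rightarrow>\<^sub>0 int)" where
  "G m = exponents_weight (THE e. expresses e m)"

definition G' :: "(nat \<times> nat) multiset \<Rightarrow> (nat \<Rightarrow>\<^sub>0 int)" where
  "G' = restrict G monomials'"

text \<open>Every monomial has exactly one admissible expression, so \<^const>\<open>G\<close> is well defined.\<close>

lemma at_most_one_nonzero_simps:
  "at_most_one_nonzero [x, y] \<longleftrightarrow> x = 0 \<or> y = 0"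
  "at_most_one_nonzero [x, y, z] \<longleftrightarrow> x = 0 \<and> y = 0 \<or> x = 0 \<and> z = 0 \<or> y = 0 \<and> z = 0"
  by (auto simp: at_most_one_nonzero_def)

lemma atLeastAtMost_1_4: "{1..4::nat} = {1, 2, 3, 4}"
  by auto

lemma count_expression_value:
  "count (expression_value e) (3, 1) = ex_a e 3 + ex_p e"
  "count (expression_value e) (3, 3) = ex_a e 3 + ex_q e"
  "i \<in> {1, 2, 4} \<Longrightarrow> count (expression_value e) (i, 0) = ex_a e i + ex_qi e i + ex_ri e i + ex_si e i"
  "i \<in> {1, 2, 4} \<Longrightarrow> count (expression_value e) (i, 2) = ex_a e i + ex_pi e i + ex_ri e i + ex_ti e i"
  "i \<in> {1, 2, 4} \<Longrightarrow> count (expression_value e) (i, 4) = ex_a e i + ex_pi e i + ex_qi e i + ex_ui e i"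
  "x \<notin> vertices \<Longrightarrow> count (expression_value e) x = 0"
  unfolding expression_value_def atLeastAtMost_1_4 F_monomial_def vertices_def by auto

lemma triple_unique:
  fixes a p q r s t u :: nat
  assumes "x = a + q + r + s" "y = a + p + r + t" "z = a + p + q + u"
    and "p = 0 \<and> q = 0 \<or> p = 0 \<and> r = 0 \<or> q = 0 \<and> r = 0"
    and "s = 0 \<and> t = 0 \<or> s = 0 \<and> u = 0 \<or> t = 0 \<and> u = 0"
    and "p = 0 \<or> s = 0" "q = 0 \<or> t = 0" "r = 0 \<or> u = 0"
  shows "a = min x (min y z) \<and> p = min y z - a \<and> q = min x z - a \<and> r = min x y - a \<and>
    s = x - a - q - r \<and> t = y - a - p - r \<and> u = z - a - p - q"
  using assms by (elim disjE conjE) auto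

lemma triple_exists:
  fixes x y z :: nat
  defines "a \<equiv> min x (min y z)"
  defines "p \<equiv> min y z - a" and "q \<equiv> min x z - a" and "r \<equiv> min x y - a"
  defines "s \<equiv> x - a - q - r" and "t \<equiv> y - a - p - r" and "u \<equiv> z - a - p - q"
  shows "x = a + q + r + s \<and> y = a + p + r + t \<and> z = a + p + q + u \<and>
    (p = 0 \<and> q = 0 \<or> p = 0 \<and> r = 0 \<or> q = 0 \<and> r = 0) \<and>
    (s = 0 \<and> t = 0 \<or> s = 0 \<and> u = 0 \<or> t = 0 \<and> u = 0) \<and>
    (p = 0 \<or> s = 0) \<and> (q = 0 \<or> t = 0) \<and> (r = 0 \<or> u = 0)"
proof -
  consider "x \<le> y" "x \<le> z" | "y \<le> x" "y \<le> z" | "z \<le> x" "z \<le> y"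
    by linarith
  then show ?thesis
    unfolding assms by cases (simp_all add: min_def)
qed

lemma expresses_unique:
  assumes "expresses e m" "expresses f m"
  shows "e = f"
proof -
  have idx: "ex_a e i = ex_a f i \<and> ex_pi e i = ex_pi f i \<and> ex_qi e i = ex_qi f i \<and>
      ex_ri e i = ex_ri f i \<and> ex_si e i = ex_si f i \<and> ex_ti e i = ex_ti f i \<and> ex_ui e i = ex_ui f i"
    if i: "i \<in> {1, 2, 4}" for i
  proof -
    have "ex_a g i = min (count m (i, 0)) (min (count m (i, 2)) (count m (i, 4))) \<and>
        ex_pi g i = min (count m (i, 2)) (count m (i, 4)) - ex_a g i \<and>
        ex_qi g i = min (count m (i, 0)) (count m (i, 4)) - ex_a g i \<and>
        ex_ri g i = min (count m (i, 0)) (count m (i, 2)) - ex_a g i \<and>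
        ex_si g i = count m (i, 0) - ex_a g i - ex_qi g i - ex_ri g i \<and>
        ex_ti g i = count m (i, 2) - ex_a g i - ex_pi g i - ex_ri g i \<and>
        ex_ui g i = count m (i, 4) - ex_a g i - ex_pi g i - ex_qi g i"
      if "expresses g m" for g
    proof (rule triple_unique)
      have m: "m = expression_value g" and adm: "admissible g"
        using that by (simp_all add: expresses_def)
      note adm_i = bspec[OF conjunct2[OF adm[unfolded admissible_def at_most_one_nonzero_simps]] i]
      show "count m (i, 0) = ex_a g i + ex_qi g i + ex_ri g i + ex_si g i"
        "count m (i, 2) = ex_a g i + ex_pi g i + ex_ri g i + ex_ti g i"
        "count m (i, 4) = ex_a g i + ex_pi g i + ex_qi g i + ex_ui g i"
        unfolding m by (fact count_expression_value(3-5)[OF i])+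
      show "ex_pi g i = 0 \<and> ex_qi g i = 0 \<or> ex_pi g i = 0 \<and> ex_ri g i = 0 \<or> ex_qi g i = 0 \<and> ex_ri g i = 0"
        "ex_si g i = 0 \<and> ex_ti g i = 0 \<or> ex_si g i = 0 \<and> ex_ui g i = 0 \<or> ex_ti g i = 0 \<and> ex_ui g i = 0"
        "ex_pi g i = 0 \<or> ex_si g i = 0" "ex_qi g i = 0 \<or> ex_ti g i = 0" "ex_ri g i = 0 \<or> ex_ui g i = 0"
        by (simp_all only: adm_i simp_thms)
    qed
    from this[OF assms(1)] this[OF assms(2)] show ?thesis by simp
  qed
  have three: "ex_a e 3 = ex_a f 3 \<and> ex_p e = ex_p f \<and> ex_q e = ex_q f"
  proof -
    have "ex_a g 3 = min (count m (3, 1)) (count m (3, 3)) \<and>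
        ex_p g = count m (3, 1) - ex_a g 3 \<and> ex_q g = count m (3, 3) - ex_a g 3"
      if "expresses g m" for g
    proof -
      have m: "m = expression_value g" and adm: "admissible g"
        using that by (simp_all add: expresses_def)
      have "ex_p g = 0 \<or> ex_q g = 0"
        by (fact conjunct1[OF adm[unfolded admissible_def at_most_one_nonzero_simps]])
      then show ?thesis
        unfolding m count_expression_value(1,2) by (elim disjE) simp_all
    qed
    from this[OF assms(1)] this[OF assms(2)] show ?thesis by simp
  qed
  have supp: "proper_support e" "proper_support f"
    using assms by (auto simp: expresses_def)
  have "ex_a e i = ex_a f i" for i
  proof -
    consider "i \<in> {1, 2, 4}" | "i = 3" | "i \<notin> {1..4}"
      unfolding atLeastAtMost_1_4 by blast
    then show ?thesis
    proof cases
      case 1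
      then show ?thesis using idx by blast
    next
      case 2
      then show ?thesis using three by blast
    next
      case 3
      then show ?thesis using supp by (simp add: proper_support_def del: atLeastAtMost_iff insert_iff)
    qed
  qed
  moreover have "ex_pi e i = ex_pi f i \<and> ex_qi e i = ex_qi f i \<and> ex_ri e i = ex_ri f i \<and>
      ex_si e i = ex_si f i \<and> ex_ti e i = ex_ti f i \<and> ex_ui e i = ex_ui f i" for i
  proof (cases "i \<in> {1, 2, 4}")
    case True
    then show ?thesis using idx by blast
  next
    case False
    then show ?thesis using supp by (simp add: proper_support_def del: atLeastAtMost_iff insert_iff)
  qed
  ultimately show ?thesis
    using three by (intro exponents.equality) auto
qed

lemma expresses_exists:
  assumes "m \<in> monomials"
  shows "\<exists>e. expresses e m"
proof -
  define I where "I = {1, 2, 4 :: nat}"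
  define x y z where "x i = count m (i, 0)" and "y i = count m (i, 2)" and "z i = count m (i, 4)"
    for i :: nat
  define a where "a i = min (x i) (min (y i) (z i))" for i
  define p q r where "p i = min (y i) (z i) - a i" and "q i = min (x i) (z i) - a i"
    and "r i = min (x i) (y i) - a i" for i
  define s t u where "s i = x i - a i - q i - r i" and "t i = y i - a i - p i - r i"
    and "u i = z i - a i - p i - q i" for i
  define b where "b = min (count m (3, 1)) (count m (3, 3))"
  define on_I where "on_I f i = (if i \<in> I then f i else 0)" for f :: "nat \<Rightarrow> nat" and i
  define e where "e = \<lparr> ex_a = (\<lambda>i. if i = 3 then b else on_I a i),
      ex_p = count m (3, 1) - b, ex_q = count m (3, 3) - b,
      ex_pi = on_I p, ex_qi = on_I q, ex_ri = on_I r,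
      ex_si = on_I s, ex_ti = on_I t, ex_ui = on_I u \<rparr>"
  have triple: "x i = a i + q i + r i + s i \<and> y i = a i + p i + r i + t i \<and>
    z i = a i + p i + q i + u i \<and>
    (p i = 0 \<and> q i = 0 \<or> p i = 0 \<and> r i = 0 \<or> q i = 0 \<and> r i = 0) \<and>
    (s i = 0 \<and> t i = 0 \<or> s i = 0 \<and> u i = 0 \<or> t i = 0 \<and> u i = 0) \<and>
    (p i = 0 \<or> s i = 0) \<and> (q i = 0 \<or> t i = 0) \<and> (r i = 0 \<or> u i = 0)" for i
    unfolding s_def t_def u_def p_def q_def r_def a_def by (rule triple_exists)
  have sel: "ex_a e i = a i" "ex_pi e i = p i" "ex_qi e i = q i" "ex_ri e i = r i"
    "ex_si e i = s i" "ex_ti e i = t i" "ex_ui e i = u i" if "i \<in> {1, 2, 4}" for i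
    using that by (auto simp: e_def on_I_def I_def)
  have sel3: "ex_a e 3 = b" "ex_p e = count m (3, 1) - b" "ex_q e = count m (3, 3) - b"
    by (auto simp: e_def)
  have "proper_support e"
    by (auto simp: proper_support_def e_def on_I_def I_def)
  moreover have "admissible e"
    unfolding admissible_def at_most_one_nonzero_simps
  proof (intro conjI ballI)
    show "ex_p e = 0 \<or> ex_q e = 0"
      by (simp add: sel3 b_def min_def)
  qed (use triple in \<open>simp_all add: sel\<close>)
  moreover have "m = expression_value e"
  proof (rule multiset_eqI)
    fix c
    consider "c = (3, 1)" | "c = (3, 3)" | i where "i \<in> {1, 2, 4}" "c \<in> {(i, 0), (i, 2), (i, 4)}"
      | "c \<notin> vertices"
      unfolding vertices_def by blast
    then show "count m c = count (expression_value e) c"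
    proof cases
      case 3
      have "count m (i, 0) = count (expression_value e) (i, 0)"
        "count m (i, 2) = count (expression_value e) (i, 2)"
        "count m (i, 4) = count (expression_value e) (i, 4)"
        unfolding count_expression_value(3-5)[OF 3(1)] sel[OF 3(1)]
        by (simp_all only: triple[of i, unfolded x_def y_def z_def])
      then show ?thesis
        using 3(2) by blast
    next
      case 4
      then have "c \<notin># m"
        using assms by (auto simp: monomials_def)
      then show ?thesis
        using 4 by (simp add: count_expression_value not_in_iff)
    qed (simp_all add: count_expression_value sel3 b_def del: One_nat_def)
  qed
  ultimately show ?thesis
    by (auto simp: expresses_def)
qed

lemma expresses_ex1: "m \<in> monomials \<Longrightarrow> \<exists>!e. expresses e m"
  using expresses_exists expresses_unique by blast

end

theory Submission
  imports Defs
begin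

text \<open>
  The map \<^const>\<open>G\<close> decouples into small pieces. A monomial of \<^const>\<open>monomials'\<close> consists of
  a pair \<open>(b, c)\<close> of exponents of \<open>3\<^sub>1\<close>, \<open>3\<^sub>3\<close> with minimum \<open>0\<close> and, for \<open>i = 1, 2, 4\<close>, a triple
  \<open>(x, y, z)\<close> of exponents of \<open>i\<^sub>0\<close>, \<open>i\<^sub>2\<close>, \<open>i\<^sub>4\<close> with minimum \<open>0\<close>. When the minimum is \<open>0\<close>, the
  piecewise definition of \<^const>\<open>G\<close> collapses: the coefficients of the simple roots with
  indices \<open>v\<^sub>i\<close> and \<open>w\<^sub>i\<close> are \<open>v = x - min y z\<close> and \<open>w = x - y + z\<close>, so they see
  the \<open>i\<close>-th triple alone, and that triple adds \<open>max 0 (w - max 0 v)\<close> to the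
  coefficient of \<open>\<alpha>\<^sub>3\<close> (\<open>lookup_G_v\<close>, \<open>lookup_G_w\<close>, \<open>lookup_G_3\<close>).

  The map \<open>(x, y, z) \<mapsto> (v, w)\<close> is a bijection onto the pairs of integers: either \<open>x = 0\<close> or
  \<open>min y z = 0\<close>, so \<open>v\<close> has positive part \<open>x\<close> and negative part \<open>min y z\<close>, after which
  \<open>w - x = z - y\<close> separates \<open>y\<close> from \<open>z\<close> (\<open>triple_from_coordinates\<close>, \<open>triple_of_coordinates\<close>).
  Hence the six coefficients at the \<open>v\<^sub>i\<close> and \<open>w\<^sub>i\<close>, which are arbitrary integers, determine the
  three triples. The contribution of the triples to the coefficient of \<open>\<alpha>\<^sub>3\<close> depends on these six
  integers only, so the remaining difference \<open>c - b\<close> is again an arbitrary integer, and it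
  determines \<open>(b, c)\<close>. As \<open>3\<close>, the \<open>v\<^sub>i\<close> and the \<open>w\<^sub>i\<close> exhaust \<open>{0..6}\<close>, this gives bijectivity.
\<close>

section \<open>Coefficients of the weight of an expression\<close>

lemma lookup_exponents_weight:
  "Poly_Mapping.lookup (exponents_weight e) 3 =
     int (ex_q e) - int (ex_p e) + (\<Sum>i\<in>{1, 2, 4}. int (ex_qi e i) + int (ex_ui e i))"
  "i \<in> {1, 2, 4} \<Longrightarrow> Poly_Mapping.lookup (exponents_weight e) (v_index i) =
     int (ex_qi e i) + int (ex_ri e i) + int (ex_si e i) - int (ex_pi e i)"
  "i \<in> {1, 2, 4} \<Longrightarrow> Poly_Mapping.lookup (exponents_weight e) (w_index i) =
     2 * int (ex_qi e i) + int (ex_si e i) + int (ex_ui e i) - int (ex_ti e i)"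
  unfolding exponents_weight_def \<alpha>_def v_index_def w_index_def
  by (auto simp: lookup_add lookup_minus simp del: single_one)

lemma indices_exhaust: "{0..6} = insert 3 (v_index ` {1, 2, 4} \<union> w_index ` {1, 2, 4})"
  by (auto simp: v_index_def w_index_def)

lemma exponents_weight_in_root_lattice: "exponents_weight e \<in> root_lattice"
proof -
  have "k \<in> {0..6}" if "Poly_Mapping.lookup (exponents_weight e) k \<noteq> 0" for k
  proof (rule ccontr)
    assume "k \<notin> {0..6}"
    then have "Poly_Mapping.lookup (exponents_weight e) k = 0"
      unfolding exponents_weight_def \<alpha>_def v_index_def w_index_def
      by (auto simp: lookup_add lookup_minus simp del: single_one)
    with that show False ..
  qed
  then show ?thesis
    by (auto simp: root_lattice_def free_Abelian_group_def in_keys_iff)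
qed

lemma root_lattice_eqI:
  assumes "g \<in> root_lattice" "h \<in> root_lattice"
    and "Poly_Mapping.lookup g 3 = Poly_Mapping.lookup h 3"
    and "\<And>i. i \<in> {1, 2, 4} \<Longrightarrow>
      Poly_Mapping.lookup g (v_index i) = Poly_Mapping.lookup h (v_index i)"
    and "\<And>i. i \<in> {1, 2, 4} \<Longrightarrow>
      Poly_Mapping.lookup g (w_index i) = Poly_Mapping.lookup h (w_index i)"
  shows "g = h"
proof (rule poly_mapping_eqI)
  fix k
  show "Poly_Mapping.lookup g k = Poly_Mapping.lookup h k"
  proof (cases "k \<in> {0..6}")
    case True
    then show ?thesis
      unfolding indices_exhaust using assms(3-5) by blast
  next
    case False
    then have "k \<notin> Poly_Mapping.keys g" "k \<notin> Poly_Mapping.keys h"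
      using assms(1,2) by (auto simp: root_lattice_def free_Abelian_group_def)
    then show ?thesis
      by (simp add: in_keys_iff)
  qed
qed

section \<open>Coefficients of G in terms of the exponents of the indeterminates\<close>

lemma monomials'_iff:
  "m \<in> monomials' \<longleftrightarrow> m \<in> monomials \<and> min (count m (3, 1)) (count m (3, 3)) = 0 \<and>
     (\<forall>i\<in>{1, 2, 4}. min (count m (i, 0)) (min (count m (i, 2)) (count m (i, 4))) = 0)"
proof -
  have min_eq_0: "min a b = 0 \<longleftrightarrow> a = 0 \<or> b = 0" for a b :: nat
    by (auto simp: min_def)
  have three: "F_monomial 3 \<subseteq># m \<longleftrightarrow> min (count m (3, 1)) (count m (3, 3)) \<noteq> 0"
    by (simp add: F_monomial_def insert_subset_eq_iff in_diff_count min_eq_0)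
  have idx: "F_monomial i \<subseteq># m \<longleftrightarrow>
      min (count m (i, 0)) (min (count m (i, 2)) (count m (i, 4))) \<noteq> 0" if "i \<in> {1, 2, 4}" for i
  proof -
    have "i \<noteq> 3"
      using that by auto
    then show ?thesis
      by (simp add: F_monomial_def insert_subset_eq_iff in_diff_count min_eq_0)
  qed
  have "(\<forall>i\<in>{1..4}. \<not> F_monomial i \<subseteq># m) \<longleftrightarrow>
      \<not> F_monomial 3 \<subseteq># m \<and> (\<forall>i\<in>{1, 2, 4}. \<not> F_monomial i \<subseteq># m)"
    unfolding atLeastAtMost_1_4 by blast
  also have "\<dots> \<longleftrightarrow> min (count m (3, 1)) (count m (3, 3)) = 0 \<and>
      (\<forall>i\<in>{1, 2, 4}. min (count m (i, 0)) (min (count m (i, 2)) (count m (i, 4))) = 0)"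
    by (simp only: three idx not_not cong: ball_cong)
  finally show ?thesis
    unfolding monomials'_def mem_Collect_eq by (rule conj_cong[OF refl])
qed

lemma monomials'D:
  assumes "m \<in> monomials'"
  shows "m \<in> monomials" "min (count m (3, 1)) (count m (3, 3)) = 0"
    and "i \<in> {1, 2, 4} \<Longrightarrow>
      min (count m (i, 0)) (min (count m (i, 2)) (count m (i, 4))) = 0"
  using assms unfolding monomials'_iff by (simp_all only: simp_thms Ball_def)

text \<open>
  The product decomposition of a triple with minimum \<open>0\<close> has \<open>a = 0\<close>, and then the three
  coefficients that it contributes become closed expressions in \<open>x\<close>, \<open>y\<close>, \<open>z\<close>. The third one is
  expressed through the first two, which is what makes the coefficient of \<open>\<alpha>\<^sub>3\<close> harmless.
\<close>

lemma triple_coefficients: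
  fixes a p q r s t u x y z :: nat
  assumes "min x (min y z) = 0"
    and "x = a + q + r + s" "y = a + p + r + t" "z = a + p + q + u"
    and "p = 0 \<and> q = 0 \<or> p = 0 \<and> r = 0 \<or> q = 0 \<and> r = 0"
    and "s = 0 \<and> t = 0 \<or> s = 0 \<and> u = 0 \<or> t = 0 \<and> u = 0"
    and "p = 0 \<or> s = 0" "q = 0 \<or> t = 0" "r = 0 \<or> u = 0"
  shows "int q + int r + int s - int p = int x - int (min y z)"
    and "2 * int q + int s + int u - int t = int x - int y + int z"
    and "int q + int u = max 0 (int x - int y + int z - max 0 (int x - int (min y z)))"
proof -
  have "a = 0"
    using assms(1-4) by (auto simp: min_def split: if_splits)
  then show "int q + int r + int s - int p = int x - int (min y z)"
    and "2 * int q + int s + int u - int t = int x - int y + int z"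
    and "int q + int u = max 0 (int x - int y + int z - max 0 (int x - int (min y z)))"
    using assms by (elim disjE conjE; simp add: min_def max_def split: if_splits)+
qed

lemma G_coefficients:
  assumes "m \<in> monomials'"
  shows G_in_root_lattice: "G m \<in> root_lattice"
    and lookup_G_v: "i \<in> {1, 2, 4} \<Longrightarrow> Poly_Mapping.lookup (G m) (v_index i) =
      int (count m (i, 0)) - int (min (count m (i, 2)) (count m (i, 4)))"
    and lookup_G_w: "i \<in> {1, 2, 4} \<Longrightarrow> Poly_Mapping.lookup (G m) (w_index i) =
      int (count m (i, 0)) - int (count m (i, 2)) + int (count m (i, 4))"
    and lookup_G_3: "Poly_Mapping.lookup (G m) 3 =
      int (count m (3, 3)) - int (count m (3, 1)) +
      (\<Sum>i\<in>{1, 2, 4}. max 0 (Poly_Mapping.lookup (G m) (w_index i)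
                           - max 0 (Poly_Mapping.lookup (G m) (v_index i))))"
proof -
  define e where "e = (THE e. expresses e m)"
  have "expresses e m"
    unfolding e_def by (rule theI') (rule expresses_ex1[OF monomials'D(1)[OF assms]])
  then have m: "m = expression_value e" and adm: "admissible e"
    by (simp_all add: expresses_def)
  have G: "G m = exponents_weight e"
    by (simp add: G_def e_def)
  then show "G m \<in> root_lattice"
    by (simp add: exponents_weight_in_root_lattice)
  have coeffs:
    "int (ex_qi e i) + int (ex_ri e i) + int (ex_si e i) - int (ex_pi e i) =
       int (count m (i, 0)) - int (min (count m (i, 2)) (count m (i, 4)))"
    "2 * int (ex_qi e i) + int (ex_si e i) + int (ex_ui e i) - int (ex_ti e i) =
       int (count m (i, 0)) - int (count m (i, 2)) + int (count m (i, 4))"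
    "int (ex_qi e i) + int (ex_ui e i) =
       max 0 (int (count m (i, 0)) - int (count m (i, 2)) + int (count m (i, 4))
         - max 0 (int (count m (i, 0)) - int (min (count m (i, 2)) (count m (i, 4)))))"
    if i: "i \<in> {1, 2, 4}" for i
  proof -
    note adm_i = bspec[OF conjunct2[OF adm[unfolded admissible_def at_most_one_nonzero_simps]] i]
    note counts = count_expression_value(3-5)[OF i, of e, folded m]
    note triple = triple_coefficients[OF monomials'D(3)[OF assms i] counts]
    show "int (ex_qi e i) + int (ex_ri e i) + int (ex_si e i) - int (ex_pi e i) =
       int (count m (i, 0)) - int (min (count m (i, 2)) (count m (i, 4)))"
      by (rule triple(1)) (simp_all only: adm_i simp_thms)
    show "2 * int (ex_qi e i) + int (ex_si e i) + int (ex_ui e i) - int (ex_ti e i) =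
       int (count m (i, 0)) - int (count m (i, 2)) + int (count m (i, 4))"
      by (rule triple(2)) (simp_all only: adm_i simp_thms)
    show "int (ex_qi e i) + int (ex_ui e i) =
       max 0 (int (count m (i, 0)) - int (count m (i, 2)) + int (count m (i, 4))
         - max 0 (int (count m (i, 0)) - int (min (count m (i, 2)) (count m (i, 4)))))"
      by (rule triple(3)) (simp_all only: adm_i simp_thms)
  qed
  show v: "Poly_Mapping.lookup (G m) (v_index i) =
      int (count m (i, 0)) - int (min (count m (i, 2)) (count m (i, 4)))"
    if "i \<in> {1, 2, 4}" for i
    unfolding G lookup_exponents_weight(2)[OF that] by (rule coeffs(1)[OF that])
  show w: "Poly_Mapping.lookup (G m) (w_index i) =
      int (count m (i, 0)) - int (count m (i, 2)) + int (count m (i, 4))"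
    if "i \<in> {1, 2, 4}" for i
    unfolding G lookup_exponents_weight(3)[OF that] by (rule coeffs(2)[OF that])
  have "Poly_Mapping.lookup (G m) 3 =
      int (ex_q e) - int (ex_p e) + (\<Sum>i\<in>{1, 2, 4}. int (ex_qi e i) + int (ex_ui e i))"
    unfolding G by (rule lookup_exponents_weight(1))
  also have "(\<Sum>i\<in>{1, 2, 4}. int (ex_qi e i) + int (ex_ui e i)) =
      (\<Sum>i\<in>{1, 2, 4}. max 0 (Poly_Mapping.lookup (G m) (w_index i)
                           - max 0 (Poly_Mapping.lookup (G m) (v_index i))))"
    by (rule sum.cong[OF refl]) (simp only: v w coeffs(3))
  also have "int (ex_q e) - int (ex_p e) = int (count m (3, 3)) - int (count m (3, 1))"
    unfolding m count_expression_value(1,2) by simp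
  finally show "Poly_Mapping.lookup (G m) 3 =
      int (count m (3, 3)) - int (count m (3, 1)) +
      (\<Sum>i\<in>{1, 2, 4}. max 0 (Poly_Mapping.lookup (G m) (w_index i)
                           - max 0 (Poly_Mapping.lookup (G m) (v_index i))))" .
qed

section \<open>Triples and pairs with minimum zero\<close>

lemma triple_from_coordinates:
  fixes x y z :: nat
  assumes "min x (min y z) = 0"
    and "v = int x - int (min y z)" "w = int x - int y + int z"
  shows "x = nat (max 0 v) \<and> y = nat (max 0 (- v) + max 0 (max 0 v - w)) \<and>
    z = nat (max 0 (- v) + max 0 (w - max 0 v))"
  using assms by (auto simp: min_def max_def split: if_splits)

lemma triple_of_coordinates:
  fixes v w :: int
  defines "x \<equiv> nat (max 0 v)" and "y \<equiv> nat (max 0 (- v) + max 0 (max 0 v - w))"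
    and "z \<equiv> nat (max 0 (- v) + max 0 (w - max 0 v))"
  shows "min x (min y z) = 0 \<and> int x - int (min y z) = v \<and> int x - int y + int z = w"
  unfolding assms by (auto simp: min_def max_def)

lemma pair_from_difference:
  fixes b c :: nat
  assumes "min b c = 0" and "d = int c - int b"
  shows "b = nat (- d) \<and> c = nat d"
  using assms by (auto simp: min_def split: if_splits)

lemma monomials_with_exponents:
  obtains m where "m \<in> monomials" "\<And>c. c \<in> vertices \<Longrightarrow> count m c = f c"
proof
  have fin: "finite vertices"
    by (simp add: vertices_def)
  let ?m = "\<Sum>c\<in>vertices. replicate_mset (f c) c"
  show "?m \<in> monomials"
    using fin by (auto simp: monomials_def set_mset_sum split: if_splits)
  show "count ?m c = f c" if "c \<in> vertices" for c
    using fin that by (simp add: count_sum)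
qed

section \<open>Bijectivity\<close>

lemma inj_on_G: "inj_on G monomials'"
proof (rule inj_onI)
  fix m n
  assume m: "m \<in> monomials'" and n: "n \<in> monomials'" and eq: "G m = G n"
  have triple: "count m (i, 0) = count n (i, 0) \<and> count m (i, 2) = count n (i, 2) \<and>
      count m (i, 4) = count n (i, 4)" if i: "i \<in> {1, 2, 4}" for i
  proof -
    note det = triple_from_coordinates[OF monomials'D(3)[OF _ i] lookup_G_v[OF _ i] lookup_G_w[OF _ i]]
    show ?thesis
      using det[OF m m m] det[OF n n n] unfolding eq by metis
  qed
  have diff: "int (count m (3, 3)) - int (count m (3, 1)) =
      int (count n (3, 3)) - int (count n (3, 1))"
    using lookup_G_3[OF m] lookup_G_3[OF n] unfolding eq by linarith
  have pair: "count m (3, 1) = count n (3, 1) \<and> count m (3, 3) = count n (3, 3)"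
    using pair_from_difference[OF monomials'D(2)[OF m] diff[symmetric]]
      pair_from_difference[OF monomials'D(2)[OF n] refl] by metis
  show "m = n"
  proof (rule multiset_eqI)
    fix c
    show "count m c = count n c"
    proof (cases "c \<in> vertices")
      case True
      then show ?thesis
        using triple pair unfolding vertices_def by blast
    next
      case False
      then have "c \<notin># m" "c \<notin># n"
        using m n by (auto simp: monomials'_def monomials_def)
      then show ?thesis
        by (simp add: not_in_iff)
    qed
  qed
qed

lemma G_surj_root_lattice:
  assumes "g \<in> root_lattice"
  obtains m where "m \<in> monomials'" "G m = g"
proof -
  define v w where "v i = Poly_Mapping.lookup g (v_index i)"
    and "w i = Poly_Mapping.lookup g (w_index i)" for i
  \<comment> \<open>what the exponents of \<open>3\<^sub>1\<close> and \<open>3\<^sub>3\<close> must supply once the triples have contributed to \<open>\<alpha>\<^sub>3\<close>\<close>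
  define d where "d = Poly_Mapping.lookup g 3 - (\<Sum>i\<in>{1, 2, 4}. max 0 (w i - max 0 (v i)))"
  define f :: "nat \<times> nat \<Rightarrow> nat" where "f = (\<lambda>(i, a). if (i, a) = (3, 1) then nat (- d)
      else if (i, a) = (3, 3) then nat d
      else if a = 0 then nat (max 0 (v i))
      else if a = 2 then nat (max 0 (- v i) + max 0 (max 0 (v i) - w i))
      else nat (max 0 (- v i) + max 0 (w i - max 0 (v i))))"
  obtain m where m: "m \<in> monomials" and count_m: "\<And>c. c \<in> vertices \<Longrightarrow> count m c = f c"
    using monomials_with_exponents[of f] by blast
  have pair: "count m (3, 1) = nat (- d)" "count m (3, 3) = nat d"
    by (simp_all add: count_m vertices_def f_def)
  have triple: "count m (i, 0) = nat (max 0 (v i))"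
    "count m (i, 2) = nat (max 0 (- v i) + max 0 (max 0 (v i) - w i))"
    "count m (i, 4) = nat (max 0 (- v i) + max 0 (w i - max 0 (v i)))" if "i \<in> {1, 2, 4}" for i
    using that by (auto simp: count_m vertices_def f_def)
  have m': "m \<in> monomials'"
    unfolding monomials'_iff
  proof (intro conjI ballI)
    show "min (count m (3, 1)) (count m (3, 3)) = 0"
      unfolding pair by linarith
    show "min (count m (i, 0)) (min (count m (i, 2)) (count m (i, 4))) = 0"
      if "i \<in> {1, 2, 4}" for i
      unfolding triple[OF that] by (rule conjunct1[OF triple_of_coordinates])
  qed (rule m)
  have Gv: "Poly_Mapping.lookup (G m) (v_index i) = v i"
    and Gw: "Poly_Mapping.lookup (G m) (w_index i) = w i" if "i \<in> {1, 2, 4}" for i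
    unfolding lookup_G_v[OF m' that] lookup_G_w[OF m' that] triple[OF that]
    using triple_of_coordinates[of "v i" "w i"] by blast+
  have "Poly_Mapping.lookup (G m) 3 = d + (\<Sum>i\<in>{1, 2, 4}. max 0 (w i - max 0 (v i)))"
    unfolding lookup_G_3[OF m'] pair
    by (rule arg_cong2[where f = "(+)"]) (simp, rule sum.cong, simp_all only: Gv Gw)
  then have "G m = g"
    by (intro root_lattice_eqI G_in_root_lattice m' assms)
      (simp_all only: Gv Gw v_def[symmetric] w_def[symmetric], simp add: d_def)
  with m' show ?thesis
    by (rule that)
qed

theorem proposition5p11: "bij_betw G' monomials' root_lattice"
proof -
  have "G ` monomials' = root_lattice"
    using G_in_root_lattice G_surj_root_lattice by (auto simp: image_iff) metis
  then have "bij_betw G monomials' root_lattice"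
    using inj_on_G by (simp add: bij_betw_def)
  then show ?thesis
    by (simp add: G'_def cong: bij_betw_cong)
qed

end
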